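(* Let $R$ be an infinite large Integral Domain and let $A\subseteq R$ be a $CR$-set in $(R,+)$. Then there exists $r\in R\setminus\{0\}$ such that $rR\subseteq (A-A)(A-A)$.
   Context: An integral domain $R$ is called a large Integral Domain if every nonzero ideal of $R$ has finite index in $R$ (as an additive subgroup). $\mathbb{N}=\{1,2,3,\dots\}$. Let $(S,+)$ be a commutative semigroup. A set $A\subseteq S$ is a combinatorially rich set ($CR$-set) if for each $k\in\mathbb{N}$ there exists $r\in\mathbb{N}$ such that whenever $M=(m_{i,j})$ is an $r\times k$ matrix with entries from $S$, there exist $a\in S$ and a nonempty $H\subseteq\{1,\dots,r\}$ such that for each $j\in\{1,\dots,k\}$, $a+\sum_{t\in H}m_{t,j}\in A$. Here $A-A=\{a-b:a,b\in A\}$ and, for $X,Y\subseteq R$, $XY=\{xy:x\in X,\ y\in Y\}$. *)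

theory Defs
  imports "HOL-Algebra.Algebra"
begin

locale large_integral_domain = domain R for R (structure) +
  assumes finite_index: "\<lbrakk>ideal I R; I \<noteq> {\<zero>}\<rbrakk> \<Longrightarrow> finite (a_rcosets I)"

text \<open>
  Combinatorially rich subsets of a commutative semigroup \<open>S\<close>, written multiplicatively; only
  the carrier and the operation of the record are used. The fold over \<open>H\<close> starts at \<open>a\<close>, so
  that it yields \<open>a + (\<Sum>t\<in>H. M t j)\<close> without requiring a neutral element in \<open>S\<close>; see
  \<open>foldD_eq_mult_finprod\<close> below for the case of a commutative monoid.
  The \<open>r \<times> k\<close> matrix \<open>M\<close> is a function restricted to the index range \<open>{1..r} \<times> {1..k}\<close>.
\<close>

definition CR_set :: "('a, 'b) monoid_scheme \<Rightarrow> 'a set \<Rightarrow> bool" where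
  "CR_set S A \<longleftrightarrow> A \<subseteq> carrier S \<and>
    (\<forall>k::nat. k \<ge> 1 \<longrightarrow> (\<exists>r::nat. r \<ge> 1 \<and>
      (\<forall>M :: nat \<Rightarrow> nat \<Rightarrow> 'a. (\<forall>i\<in>{1..r}. \<forall>j\<in>{1..k}. M i j \<in> carrier S) \<longrightarrow>
        (\<exists>a\<in>carrier S. \<exists>H. H \<noteq> {} \<and> H \<subseteq> {1..r} \<and>
          (\<forall>j\<in>{1..k}. foldD (carrier S) (\<lambda>t x. M t j \<otimes>\<^bsub>S\<^esub> x) a H \<in> A)))))"

lemma (in comm_monoid) foldD_eq_mult_finprod:
  assumes "finite H" "f \<in> H \<rightarrow> carrier G" "a \<in> carrier G"
  shows "foldD (carrier G) (\<lambda>t x. f t \<otimes> x) a H = a \<otimes> finprod G f H"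
proof -
  interpret LCD H "carrier G" "\<lambda>t x. f t \<otimes> x"
    using assms(2) by unfold_locales (auto simp: Pi_iff m_lcomm)
  have "foldD (carrier G) (\<lambda>t x. f t \<otimes> x) a K = a \<otimes> finprod G f K"
    if "finite K" "K \<subseteq> H" for K
    using that
  proof (induction K)
    case empty
    then show ?case using assms by simp
  next
    case (insert x K)
    then have "f \<in> K \<rightarrow> carrier G" "f x \<in> carrier G" using assms(2) by auto
    then show ?case using insert assms by (simp add: foldD_insert m_lcomm)
  qed
  then show ?thesis using assms(1) by blast
qed

definition difference_set :: "('a, 'b) ring_scheme \<Rightarrow> 'a set \<Rightarrow> 'a set" where
  "difference_set R A = {a \<ominus>\<^bsub>R\<^esub> b | a b. a \<in> A \<and> b \<in> A}"

end

theory Submission imports Defs begin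

text \<open>
  Writing \<open>D = A - A\<close>, the \<open>CR\<close>-property gives for finitely many sequences a common index set \<open>H\<close>
  over which all of them sum into \<open>D\<close>. For one sequence, let \<open>n\<close> be the length required. Fix
  \<open>c\<^sub>1, \<dots>, c\<^sub>n\<close> with nonzero subset sums \<open>c\<^sub>H\<close>, and let \<open>K \<noteq> 0\<close> be a common multiple of
  them. Applying the property to the sequences \<open>(e\<^sub>t K / c\<^sub>H)\<^sub>t\<close>, where \<open>e\<close> again has nonzero
  subset sums, yields a nonzero multiple \<open>k\<close> of \<open>K\<close> with \<open>k / c\<^sub>H \<in> D\<close> for all \<open>H\<close>. For
  \<open>m \<in> R\<close>, the sequence \<open>(c\<^sub>t m)\<^sub>t\<close> gives some \<open>H\<close> with \<open>c\<^sub>H m \<in> D\<close>, so that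
  \<open>k m = (k / c\<^sub>H) (c\<^sub>H m) \<in> D D\<close>.
\<close>

text \<open>The translate \<open>a\<close> is common to all columns, so it cancels in a difference
  with a column whose sum is zero. An arbitrary finite index set \<open>J\<close> lets columns later
  be indexed by subsets of \<open>{1..n}\<close>.\<close>

lemma (in abelian_group) CR_set_imp_sums_in_difference_set:
  fixes J :: "'c set"
  assumes "CR_set (add_monoid G) A" and "finite J"
  shows "\<exists>r::nat. \<forall>M. (\<forall>i\<in>{1..r}. \<forall>j\<in>J. M i j \<in> carrier G) \<longrightarrow>
    (\<exists>H. H \<noteq> {} \<and> H \<subseteq> {1..r} \<and> (\<forall>j\<in>J. (\<Oplus>t\<in>H. M t j) \<in> difference_set G A))"
proof -
  obtain h where h: "bij_betw h {1..card J} J"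
    using ex_bij_betw_nat_finite_1[OF assms(2)] by blast
  \<comment> \<open>The additional column also ensures \<open>?k \<ge> 1\<close> when
    \<open>J\<close> is empty.\<close>
  let ?k = "Suc (card J)"
  obtain r :: nat where r: "\<And>M. \<forall>i\<in>{1..r}. \<forall>j\<in>{1..?k}. M i j \<in> carrier G \<Longrightarrow>
      \<exists>a\<in>carrier G. \<exists>H. H \<noteq> {} \<and> H \<subseteq> {1..r} \<and>
        (\<forall>j\<in>{1..?k}. foldD (carrier G) (\<lambda>t x. M t j \<oplus> x) a H \<in> A)"
    using assms(1)[unfolded CR_set_def, THEN conjunct2, rule_format, of ?k] by auto
  show ?thesis
  proof (rule exI[of _ r], intro allI impI)
    fix M :: "nat \<Rightarrow> 'c \<Rightarrow> 'a"
    assume M: "\<forall>i\<in>{1..r}. \<forall>j\<in>J. M i j \<in> carrier G"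
    \<comment> \<open>The zero column makes \<open>a\<close> itself an element of \<open>A\<close>.\<close>
    define N where "N i j = (if j \<le> card J then M i (h j) else \<zero>)" for i j
    have N: "N i j \<in> carrier G" if "i \<in> {1..r}" "j \<in> {1..?k}" for i j
      using M that bij_betwE[OF h] by (auto simp: N_def)
    obtain a H where a: "a \<in> carrier G" and H: "H \<noteq> {}" "H \<subseteq> {1..r}"
      and foldD: "\<forall>j\<in>{1..?k}. foldD (carrier G) (\<lambda>t x. N t j \<oplus> x) a H \<in> A"
      using r[of N] N by auto
    have "finite H" using H(2) finite_subset by blast
    have sum_in: "a \<oplus> (\<Oplus>t\<in>H. N t j) \<in> A" if "j \<in> {1..?k}" for j
      using foldD[rule_format, OF that] add.foldD_eq_mult_finprod[OF \<open>finite H\<close>, of "\<lambda>t. N t j" a] a N H(2) that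
      by (auto simp: finsum_def Pi_iff subset_iff)
    have "(\<Oplus>t\<in>H. N t ?k) = \<zero>" by (simp add: N_def add.finprod_one_eqI)
    then have aA: "a \<in> A" using sum_in[of ?k] a by simp
    have "(\<Oplus>t\<in>H. M t j) \<in> difference_set G A" if j: "j \<in> J" for j
    proof -
      obtain i where i: "i \<in> {1..card J}" "h i = j"
        using h j unfolding bij_betw_def by (metis imageE)
      have s: "(\<Oplus>t\<in>H. M t j) \<in> carrier G"
        using M H(2) j by (intro finsum_closed) auto
      have "a \<oplus> (\<Oplus>t\<in>H. M t j) \<in> A" using sum_in[of i] i by (simp add: N_def)
      moreover have "(\<Oplus>t\<in>H. M t j) = (a \<oplus> (\<Oplus>t\<in>H. M t j)) \<ominus> a"
        using a s by (simp add: minus_eq a_ac r_neg2)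
      ultimately show ?thesis using aA unfolding difference_set_def by blast
    qed
    with H show "\<exists>H. H \<noteq> {} \<and> H \<subseteq> {1..r} \<and> (\<forall>j\<in>J. (\<Oplus>t\<in>H. M t j) \<in> difference_set G A)"
      by blast
  qed
qed

text \<open>Greedy choice: each new term has only finitely many values to avoid, the negatives of
  the earlier subset sums.\<close>

lemma (in abelian_group) ex_nonzero_subset_sums:
  assumes "infinite (carrier G)"
  shows "\<exists>c. range c \<subseteq> carrier G \<and>
    (\<forall>H. H \<noteq> {} \<and> H \<subseteq> {1..n::nat} \<longrightarrow> (\<Oplus>t\<in>H. c t) \<noteq> \<zero>)"
proof (induction n)
  case 0
  show ?case by (intro exI[of _ "\<lambda>_. \<zero>"]) auto
next
  case (Suc n)
  then obtain c where "range c \<subseteq> carrier G"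
    and nz: "\<forall>H. H \<noteq> {} \<and> H \<subseteq> {1..n} \<longrightarrow> (\<Oplus>t\<in>H. c t) \<noteq> \<zero>"
    by auto
  then have c: "c t \<in> carrier G" for t by blast
  \<comment> \<open>The empty set is included, which forces \<open>x \<noteq> \<zero>\<close> and so
    settles \<open>H = {Suc n}\<close>.\<close>
  let ?B = "(\<lambda>H. \<ominus> (\<Oplus>t\<in>H. c t)) ` Pow {1..n}"
  have "infinite (carrier G - ?B)" using assms by (intro Diff_infinite_finite) simp_all
  then obtain x where x: "x \<in> carrier G" "x \<notin> ?B"
    using infinite_imp_nonempty by blast
  then have x_new: "x \<noteq> \<ominus> (\<Oplus>t\<in>H. c t)" if "H \<subseteq> {1..n}" for H
    using that by blast
  let ?c = "c(Suc n := x)"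
  have "(\<Oplus>t\<in>H. ?c t) \<noteq> \<zero>" if H: "H \<noteq> {}" "H \<subseteq> {1..Suc n}" for H
  proof -
    define H' where "H' = H - {Suc n}"
    have H': "H' \<subseteq> {1..n}" "Suc n \<notin> H'" "finite H'"
      using H(2) finite_subset[of H' "{1..n}"] by (auto simp: H'_def subset_iff le_Suc_eq)
    have eq: "(\<Oplus>t\<in>H'. ?c t) = (\<Oplus>t\<in>H'. c t)"
      using H'(2) c by (intro finsum_cong') auto
    show ?thesis
    proof (cases "Suc n \<in> H")
      case True
      then have "(\<Oplus>t\<in>H. ?c t) = (\<Oplus>t\<in>insert (Suc n) H'. ?c t)"
        by (simp add: H'_def insert_absorb)
      also have "\<dots> = x \<oplus> (\<Oplus>t\<in>H'. c t)"
        using H' c x(1) by (subst finsum_insert) (auto simp: eq)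
      also have "\<dots> \<noteq> \<zero>"
        using x_new[OF H'(1)] x c minus_equality[of x "\<Oplus>t\<in>H'. c t"] by (auto simp: finsum_closed)
      finally show ?thesis .
    next
      case False
      then show ?thesis using nz H(1) eq H' by (simp add: H'_def)
    qed
  qed
  then show ?case using c x by (intro exI[of _ ?c]) auto
qed

text \<open>The product of all \<open>s p\<close> serves; it is nonzero because there are no zero
  divisors.\<close>

lemma (in domain) ex_nonzero_common_multiple:
  assumes "finite P" and "\<And>p. p \<in> P \<Longrightarrow> s p \<in> carrier R - {\<zero>}"
  shows "\<exists>K\<in>carrier R - {\<zero>}. \<forall>p\<in>P. \<exists>q\<in>carrier R. K = q \<otimes> s p"
  using assms
proof (induction P)
  case empty
  show ?case by (intro bexI[of _ \<one>]) auto
next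
  case (insert x P)
  then obtain K q where K: "K \<in> carrier R - {\<zero>}"
    and q: "\<And>p. p \<in> P \<Longrightarrow> q p \<in> carrier R \<and> K = q p \<otimes> s p"
    by (metis insertCI)
  have sx: "s x \<in> carrier R - {\<zero>}" using insert.prems by simp
  have "\<exists>q\<in>carrier R. K \<otimes> s x = q \<otimes> s p" if "p \<in> insert x P" for p
  proof (cases "p = x")
    case True
    then show ?thesis using K by blast
  next
    case False
    then have "p \<in> P" using that by simp
    then have "K \<otimes> s x = (s x \<otimes> q p) \<otimes> s p"
      using q[of p] K sx insert.prems[of p] by (metis DiffD1 insertCI m_assoc m_comm)
    then show ?thesis using q[OF \<open>p \<in> P\<close>] sx by blast
  qed
  then show ?case using K sx integral_iff by (intro bexI[of _ "K \<otimes> s x"]) auto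
qed

theorem (in domain) CR_set_imp_multiples_in_difference_set_product:
  assumes inf: "infinite (carrier R)" and CR: "CR_set (add_monoid R) A"
  shows "\<exists>r\<in>carrier R - {\<zero>}. r <# carrier R \<subseteq> difference_set R A <#> difference_set R A"
proof -
  let ?D = "difference_set R A"
  \<comment> \<open>A single column, indexed by \<open>()\<close>, fixes the length \<open>n\<close>
    before \<open>c\<close> is chosen.\<close>
  obtain n :: nat where n1: "\<forall>M. (\<forall>i\<in>{1..n}. \<forall>j\<in>{()}. M i j \<in> carrier R) \<longrightarrow>
      (\<exists>H. H \<noteq> {} \<and> H \<subseteq> {1..n} \<and> (\<forall>j\<in>{()}. (\<Oplus>t\<in>H. M t j) \<in> ?D))"
    using CR_set_imp_sums_in_difference_set[OF CR, of "{()}"] by auto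
  have n: "\<exists>H. H \<noteq> {} \<and> H \<subseteq> {1..n} \<and> (\<Oplus>t\<in>H. M t) \<in> ?D"
    if "\<forall>i\<in>{1..n}. M i \<in> carrier R" for M
    using n1[rule_format, of "\<lambda>i _. M i"] that by simp
  obtain c where c: "range c \<subseteq> carrier R"
    and c_nz: "\<forall>H. H \<noteq> {} \<and> H \<subseteq> {1..n} \<longrightarrow> (\<Oplus>t\<in>H. c t) \<noteq> \<zero>"
    using ex_nonzero_subset_sums[OF inf, of n] by auto
  define P where "P = Pow {1..n} - {{}}"
  define s where "s H = (\<Oplus>t\<in>H. c t)" for H
  have "finite P" by (simp add: P_def)
  have s: "s H \<in> carrier R - {\<zero>}" if "H \<in> P" for H
    using that c c_nz by (auto simp: P_def s_def image_subset_iff intro!: finsum_closed)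
  \<comment> \<open>\<open>q H\<close> stands for the quotient of \<open>K\<close> by
    \<open>s H\<close>.\<close>
  obtain K q where K: "K \<in> carrier R - {\<zero>}"
    and q: "\<And>H. H \<in> P \<Longrightarrow> q H \<in> carrier R" "\<And>H. H \<in> P \<Longrightarrow> K = q H \<otimes> s H"
    using ex_nonzero_common_multiple[of P s, OF \<open>finite P\<close> s] by metis
  \<comment> \<open>One column for every \<open>H\<close> in \<open>P\<close>, since the
    \<open>H\<close> that occurs later depends on \<open>m\<close>.\<close>
  obtain n' :: nat where n': "\<forall>M. (\<forall>i\<in>{1..n'}. \<forall>H\<in>P. M i H \<in> carrier R) \<longrightarrow>
      (\<exists>L. L \<noteq> {} \<and> L \<subseteq> {1..n'} \<and> (\<forall>H\<in>P. (\<Oplus>t\<in>L. M t H) \<in> ?D))"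
    using CR_set_imp_sums_in_difference_set[OF CR \<open>finite P\<close>] ..
  \<comment> \<open>Constant columns \<open>q H\<close> would sum to \<open>card L\<close> times
    \<open>q H\<close>, which can vanish in positive characteristic; the weights \<open>e\<close>
    prevent this.\<close>
  obtain e where e: "range e \<subseteq> carrier R"
    and e_nz: "\<forall>L. L \<noteq> {} \<and> L \<subseteq> {1..n'} \<longrightarrow> (\<Oplus>t\<in>L. e t) \<noteq> \<zero>"
    using ex_nonzero_subset_sums[OF inf, of n'] by auto
  obtain L where L: "L \<noteq> {}" "L \<subseteq> {1..n'}"
    and L_in: "\<forall>H\<in>P. (\<Oplus>t\<in>L. e t \<otimes> q H) \<in> ?D"
    using n'[THEN spec, of "\<lambda>t H. e t \<otimes> q H"] e q(1) by (auto simp: image_subset_iff)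
  have "finite L" using L(2) finite_subset by blast
  define E where "E = (\<Oplus>t\<in>L. e t)"
  have E: "E \<in> carrier R - {\<zero>}"
    using e e_nz L by (auto simp: E_def intro!: finsum_closed)
  \<comment> \<open>As \<open>L\<close> is common to all columns, the same factor \<open>E\<close>
    comes out of each.\<close>
  have Eq_in: "E \<otimes> q H \<in> ?D" if "H \<in> P" for H
    using L_in[rule_format, OF that] finsum_ldistr[OF \<open>finite L\<close> q(1)[OF that], of e] e
    by (auto simp: E_def image_subset_iff)
  have "E \<otimes> K \<otimes> m \<in> ?D <#> ?D" if m: "m \<in> carrier R" for m
  proof -
    obtain H where H: "H \<noteq> {}" "H \<subseteq> {1..n}" "(\<Oplus>t\<in>H. c t \<otimes> m) \<in> ?D"
      using n[of "\<lambda>t. c t \<otimes> m"] c m by (auto simp: image_subset_iff)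
    have "H \<in> P" using H by (simp add: P_def)
    have "finite H" using H(2) finite_subset by blast
    then have "s H \<otimes> m \<in> ?D"
      using H(3) finsum_ldistr[OF _ m, of H c] c by (auto simp: s_def image_subset_iff)
    \<comment> \<open>The factorization varies with \<open>H\<close>, hence with \<open>m\<close>,
      but the multiplier \<open>E \<otimes> K\<close> does not.\<close>
    moreover have "E \<otimes> K \<otimes> m = (E \<otimes> q H) \<otimes> (s H \<otimes> m)"
      using q[OF \<open>H \<in> P\<close>] s[OF \<open>H \<in> P\<close>] E m by (simp add: m_assoc)
    ultimately show ?thesis using Eq_in[OF \<open>H \<in> P\<close>] by (auto simp: set_mult_def)
  qed
  then show ?thesis
    using E K integral_iff by (intro bexI[of _ "E \<otimes> K"]) (auto simp: l_coset_def)
qed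

theorem corollary4p5:
  fixes R :: "('a, 'b) ring_scheme" and A :: "'a set"
  assumes "large_integral_domain R"
    and "infinite (carrier R)"
    and "CR_set (add_monoid R) A"
  shows "\<exists>r\<in>carrier R - {\<zero>\<^bsub>R\<^esub>}.
    r <#\<^bsub>R\<^esub> carrier R \<subseteq> difference_set R A <#>\<^bsub>R\<^esub> difference_set R A"
  using domain.CR_set_imp_multiples_in_difference_set_product[OF _ assms(2,3)] assms(1)
  by (simp add: large_integral_domain_def)

end
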